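(* Let $R$ be a commutative ring with $1$ such that $\frac12\in R$, let $\mathcal{X}_R=\mathrm{Hom}(R,\mathbb{R})$ be nonempty, and assume the map $R\to C(\mathcal{X}_R)$, $a\mapsto\hat a$, is injective. Let $K$ be a closed subset of $\mathcal{X}_R$ and $d\ge1$ an integer. Assume that there exists $p\in R$ such that $\hat p\ge0$ on $K$ and $K_i=\{\alpha\in K:\hat p(\alpha)\in[0,i]\}$ is compact for each $i=1,2,\dots$. Let $L:R\to\mathbb{R}$ be a $\mathcal{T}_K$-continuous, $\mathbb{Z}[\frac12]$-linear map with $L(a^{2d})\ge0$ for all $a\in R$. Then there exists a Borel measure $\mu$ on $K$ such that $$L(a)=\int_K\hat a\,d\mu\qquad\text{for all }a\in R.$$
   Context: $\mathcal{X}_R=\mathrm{Hom}(R,\mathbb{R})$ is the set of unitary ring homomorphisms $\alpha:R\to\mathbb{R}$, with the subspace topology inherited from the product topology on $\mathbb{R}^R$. For $a\in R$, $\hat a:\mathcal{X}_R\to\mathbb{R}$ is $\hat a(\alpha)=\alpha(a)$. $\mathcal{T}_K$ is the topology on $R$ generated by the ring-seminorms $\rho_\alpha(a)=|\alpha(a)|$, $\alpha\in K$: a neighborhood basis at $a$ is given by the sets $\{b\in R:|\alpha_i(a-b)|<\epsilon,\ i=1,\dots,m\}$ with $\epsilon>0$ and $\alpha_1,\dots,\alpha_m\in K$. Borel measures are positive. *)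

theory Defs
  imports "HOL-Analysis.Analysis"
begin

text \<open>
  The type \<^typ>\<open>'a \<Rightarrow> real\<close> carries the product topology of
  \<^theory>\<open>HOL-Analysis.Function_Topology\<close>; all topological notions on sets of
  characters refer to subspaces of it.
\<close>

definition real_chars :: "('a::comm_ring_1 \<Rightarrow> real) set" where
  "real_chars = {\<alpha>. \<alpha> 1 = 1 \<and> (\<forall>a b. \<alpha> (a + b) = \<alpha> a + \<alpha> b) \<and> (\<forall>a b. \<alpha> (a * b) = \<alpha> a * \<alpha> b)}"

definition hat :: "'a \<Rightarrow> ('a \<Rightarrow> real) \<Rightarrow> real" where
  "hat a \<alpha> = \<alpha> a"

text \<open>
  The empty family \<open>F\<close> is allowed, so that the whole ring is a basic set; for \<open>K = {}\<close> the
  topology below is then the indiscrete one.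
\<close>

definition seminorm_ball :: "('a::comm_ring_1 \<Rightarrow> real) set \<Rightarrow> 'a \<Rightarrow> real \<Rightarrow> 'a set" where
  "seminorm_ball F a \<epsilon> = {b. \<forall>\<alpha>\<in>F. \<bar>\<alpha> (a - b)\<bar> < \<epsilon>}"

definition seminorm_topology :: "('a::comm_ring_1 \<Rightarrow> real) set \<Rightarrow> 'a topology" where
  "seminorm_topology K =
     topology_generated_by {seminorm_ball F a \<epsilon> | F a \<epsilon>. finite F \<and> F \<subseteq> K \<and> \<epsilon> > 0}"

lemma real_chars_diff:
  assumes "\<alpha> \<in> real_chars"
  shows "\<alpha> (a - b) = \<alpha> a - \<alpha> b"
proof -
  have "\<alpha> ((a - b) + b) = \<alpha> (a - b) + \<alpha> b"
    using assms unfolding real_chars_def by blast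
  then show ?thesis by simp
qed

lemma openin_seminorm_topology_iff:
  assumes "K \<subseteq> real_chars"
  shows "openin (seminorm_topology K) U \<longleftrightarrow>
    (\<forall>a\<in>U. \<exists>F \<epsilon>. finite F \<and> F \<subseteq> K \<and> \<epsilon> > 0 \<and> seminorm_ball F a \<epsilon> \<subseteq> U)"
    (is "_ \<longleftrightarrow> ?N U")
proof
  assume "openin (seminorm_topology K) U"
  then have "generate_topology_on {seminorm_ball F a \<epsilon> | F a \<epsilon>. finite F \<and> F \<subseteq> K \<and> \<epsilon> > 0} U"
    by (simp add: seminorm_topology_def openin_topology_generated_by_iff)
  then show "?N U"
  proof induction
    case Empty
    then show ?case by simp
  next
    case (Int V W)
    show ?case
    proof
      fix a assume "a \<in> V \<inter> W"
      then have "a \<in> V" "a \<in> W" by simp_all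
      from bspec[OF Int.IH(1) this(1)] obtain F \<epsilon> where
        F: "finite F" "F \<subseteq> K" "\<epsilon> > 0" "seminorm_ball F a \<epsilon> \<subseteq> V"
        by (elim exE conjE)
      from bspec[OF Int.IH(2) \<open>a \<in> W\<close>] obtain G \<delta> where
        G: "finite G" "G \<subseteq> K" "\<delta> > 0" "seminorm_ball G a \<delta> \<subseteq> W"
        by (elim exE conjE)
      have "seminorm_ball (F \<union> G) a (min \<epsilon> \<delta>) \<subseteq> seminorm_ball F a \<epsilon> \<inter> seminorm_ball G a \<delta>"
        by (auto simp: seminorm_ball_def)
      then have "finite (F \<union> G) \<and> F \<union> G \<subseteq> K \<and> min \<epsilon> \<delta> > 0 \<and>
          seminorm_ball (F \<union> G) a (min \<epsilon> \<delta>) \<subseteq> V \<inter> W"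
        using F G by auto
      then show "\<exists>F \<epsilon>. finite F \<and> F \<subseteq> K \<and> \<epsilon> > 0 \<and> seminorm_ball F a \<epsilon> \<subseteq> V \<inter> W"
        by (intro exI)
    qed
  next
    case (UN \<V>)
    show ?case
    proof
      fix a assume "a \<in> \<Union>\<V>"
      then obtain V where "V \<in> \<V>" "a \<in> V" by blast
      from bspec[OF UN.IH[OF \<open>V \<in> \<V>\<close>] \<open>a \<in> V\<close>] obtain F \<epsilon> where
        F: "finite F" "F \<subseteq> K" "\<epsilon> > 0" "seminorm_ball F a \<epsilon> \<subseteq> V"
        by (elim exE conjE)
      have "seminorm_ball F a \<epsilon> \<subseteq> \<Union>\<V>"
        using F(4) \<open>V \<in> \<V>\<close> by blast
      with F show "\<exists>F \<epsilon>. finite F \<and> F \<subseteq> K \<and> \<epsilon> > 0 \<and> seminorm_ball F a \<epsilon> \<subseteq> \<Union>\<V>"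
        by (intro exI conjI)
    qed
  next
    case (Basis B)
    then obtain F c \<epsilon> where B: "B = seminorm_ball F c \<epsilon>" "finite F" "F \<subseteq> K" "\<epsilon> > 0"
      by blast
    show ?case
    proof
      fix a assume "a \<in> B"
      define \<delta> where "\<delta> = Min (insert \<epsilon> ((\<lambda>\<alpha>. \<epsilon> - \<bar>\<alpha> (c - a)\<bar>) ` F))"
      have "\<delta> > 0"
        using B \<open>a \<in> B\<close> by (auto simp: \<delta>_def seminorm_ball_def)
      have le: "\<delta> \<le> \<epsilon> - \<bar>\<alpha> (c - a)\<bar>" if "\<alpha> \<in> F" for \<alpha>
        using B that by (auto simp: \<delta>_def intro: Min_le)
      have "seminorm_ball F a \<delta> \<subseteq> B"
      proof
        fix b assume b: "b \<in> seminorm_ball F a \<delta>"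
        have "\<bar>\<alpha> (c - b)\<bar> < \<epsilon>" if "\<alpha> \<in> F" for \<alpha>
        proof -
          have "\<alpha> \<in> real_chars" using that B assms by blast
          then have "\<alpha> (c - b) = \<alpha> (c - a) + \<alpha> (a - b)"
            by (simp add: real_chars_diff)
          moreover have "\<bar>\<alpha> (a - b)\<bar> < \<delta>"
            using b that by (simp add: seminorm_ball_def)
          ultimately show ?thesis using le[OF that] by linarith
        qed
        then show "b \<in> B" by (simp add: B seminorm_ball_def)
      qed
      with B(2,3) \<open>\<delta> > 0\<close> show "\<exists>F \<epsilon>. finite F \<and> F \<subseteq> K \<and> \<epsilon> > 0 \<and> seminorm_ball F a \<epsilon> \<subseteq> B"
        by (intro exI conjI)
    qed
  qed
next
  assume N: "?N U"
  let ?B = "{seminorm_ball F a \<epsilon> | F a \<epsilon>. finite F \<and> F \<subseteq> K \<and> \<epsilon> > 0}"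
  have mem: "a \<in> seminorm_ball F a \<epsilon>" if "F \<subseteq> K" "\<epsilon> > 0" for F a and \<epsilon> :: real
  proof -
    have "\<bar>\<alpha> (a - a)\<bar> < \<epsilon>" if "\<alpha> \<in> F" for \<alpha>
    proof -
      have "\<alpha> \<in> real_chars" using that \<open>F \<subseteq> K\<close> assms by blast
      then have "\<alpha> (a - a) = 0" by (subst real_chars_diff) simp_all
      with \<open>\<epsilon> > 0\<close> show ?thesis by (simp only: abs_zero)
    qed
    then show ?thesis unfolding seminorm_ball_def by blast
  qed
  have "U = \<Union>{V \<in> ?B. V \<subseteq> U}"
  proof
    show "U \<subseteq> \<Union>{V \<in> ?B. V \<subseteq> U}"
    proof
      fix a assume "a \<in> U"
      from bspec[OF N this] obtain F \<epsilon> where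
        F: "finite F" "F \<subseteq> K" "\<epsilon> > 0" "seminorm_ball F a \<epsilon> \<subseteq> U"
        by (elim exE conjE)
      then have "seminorm_ball F a \<epsilon> \<in> {V \<in> ?B. V \<subseteq> U}"
        by blast
      with mem[OF F(2,3), of a] show "a \<in> \<Union>{V \<in> ?B. V \<subseteq> U}"
        by (rule UnionI[rotated])
    qed
  qed blast
  moreover have "openin (seminorm_topology K) (\<Union>{V \<in> ?B. V \<subseteq> U})"
    unfolding seminorm_topology_def
    by (rule openin_Union) (auto intro!: topology_generated_by_Basis)
  ultimately show "openin (seminorm_topology K) U" by simp
qed

text \<open>
  \<open>h\<close> is the inverse of \<open>2\<close> in the ring (necessarily unique), so the scalar
  \<open>k / 2 ^ n\<close> of \<open>\<int>[1/2]\<close> acts on the ring as multiplication by \<open>of_int k * h ^ n\<close>.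
\<close>

definition dyadic_linear :: "'a::comm_ring_1 \<Rightarrow> ('a \<Rightarrow> real) \<Rightarrow> bool" where
  "dyadic_linear h L \<longleftrightarrow>
     (\<forall>a b. L (a + b) = L a + L b) \<and>
     (\<forall>(k::int) (n::nat) a. L (of_int k * h ^ n * a) = of_int k / 2 ^ n * L a)"

end

theory Submission imports Defs begin

text \<open>
  Each neighbourhood of \<open>0\<close> in \<open>\<T>\<^sub>K\<close> involves only finitely many characters, so \<open>L a\<close> is controlled
  by \<open>(\<alpha> a)\<^sub>\<alpha>\<^sub>\<in>\<^sub>F\<close> for one finite \<open>F \<subseteq> K\<close>. The image of the ring in \<open>\<real>\<^sup>F\<close> is dense, by Lagrange
  interpolation with dyadic approximations of the real coefficients. Hence \<open>L\<close> extends to an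
  \<open>\<real>\<close>-linear functional on \<open>\<real>\<^sup>F\<close>, that is \<open>L a = (\<Sum>\<alpha>\<in>F. c \<alpha> * \<alpha> a)\<close>, and evaluating \<open>L\<close> on
  \<open>2 * d\<close>-th powers of elements approximating the indicator of \<open>\<alpha>\<close> gives \<open>c \<alpha> \<ge> 0\<close>. The measure
  is a finite combination of point masses.
\<close>

section \<open>Dyadic approximation and the values of characters on dyadic multiples\<close>

lemma dyadic_floor_tendsto: "(\<lambda>n. of_int \<lfloor>r * 2 ^ n\<rfloor> / 2 ^ n :: real) \<longlonglongrightarrow> r"
proof (rule LIMSEQ_I)
  fix e :: real assume "e > 0"
  then obtain N where N: "(1/2) ^ N < e"
    using real_arch_pow_inv[of e "1/2"] by auto
  have "norm (of_int \<lfloor>r * 2 ^ n\<rfloor> / 2 ^ n - r) < e" if "n \<ge> N" for n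
  proof -
    have "\<bar>of_int \<lfloor>r * 2 ^ n\<rfloor> - r * 2 ^ n\<bar> \<le> 1" by linarith
    then have "\<bar>(of_int \<lfloor>r * 2 ^ n\<rfloor> - r * 2 ^ n) / 2 ^ n\<bar> \<le> (1/2) ^ n"
      by (simp add: divide_right_mono power_divide)
    then have "\<bar>of_int \<lfloor>r * 2 ^ n\<rfloor> / 2 ^ n - r\<bar> \<le> (1/2) ^ n"
      by (simp add: diff_divide_distrib)
    also have "\<dots> \<le> (1/2) ^ N" using that by (intro power_decreasing) auto
    finally show ?thesis using N by simp
  qed
  then show "\<exists>N. \<forall>n\<ge>N. norm (of_int \<lfloor>r * 2 ^ n\<rfloor> / 2 ^ n - r) < e" by blast
qed

lemma dyadic_linear_additive: "dyadic_linear h L \<Longrightarrow> Modules.additive L"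
  by (simp add: dyadic_linear_def Modules.additive_def)

lemma dyadic_linear_scale: "dyadic_linear h L \<Longrightarrow> L (of_int k * h ^ n * a) = of_int k / 2 ^ n * L a"
  by (simp add: dyadic_linear_def)

lemma real_chars_1: "\<alpha> \<in> real_chars \<Longrightarrow> \<alpha> 1 = 1"
  by (simp add: real_chars_def)

lemma real_chars_add: "\<alpha> \<in> real_chars \<Longrightarrow> \<alpha> (a + b) = \<alpha> a + \<alpha> b"
  by (simp add: real_chars_def)

lemma real_chars_mult: "\<alpha> \<in> real_chars \<Longrightarrow> \<alpha> (a * b) = \<alpha> a * \<alpha> b"
  by (simp add: real_chars_def)

lemma real_chars_additive: "\<alpha> \<in> real_chars \<Longrightarrow> Modules.additive \<alpha>"
  by (simp add: Modules.additive_def real_chars_add)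

lemma real_chars_power: "\<alpha> \<in> real_chars \<Longrightarrow> \<alpha> (a ^ n) = \<alpha> a ^ n"
  by (induction n) (simp_all add: real_chars_1 real_chars_mult)

lemma real_chars_of_int:
  assumes "\<alpha> \<in> real_chars"
  shows "\<alpha> (of_int k) = of_int k"
proof (induction k rule: int_induct[where k = 0])
  case base
  show ?case using additive.zero[OF real_chars_additive[OF assms]] by simp
qed (simp_all add: assms real_chars_add real_chars_diff real_chars_1)

text \<open>The relation \<open>2 * h = 1\<close> forces \<open>\<alpha> h = 1 / 2\<close>.
  Characters therefore obey the same scaling law as \<open>L\<close>, and a dyadic multiple in the
  ring can be evaluated under both by \<open>dyadic_linear_scale\<close>.\<close>

lemma real_chars_dyadic_linear:
  assumes \<alpha>: "\<alpha> \<in> real_chars" and h: "2 * h = 1"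
  shows "dyadic_linear h \<alpha>"
proof -
  have "\<alpha> (of_int 2) * \<alpha> h = 1"
    using h real_chars_1[OF \<alpha>] real_chars_mult[OF \<alpha>, of 2 h] by simp
  then have half: "\<alpha> h = 1 / 2"
    unfolding real_chars_of_int[OF \<alpha>] by simp
  show ?thesis
    using \<alpha> by (simp add: half dyadic_linear_def real_chars_add real_chars_mult real_chars_power
        real_chars_of_int power_divide)
qed

section \<open>Density of the image of the ring in \<open>\<real>\<^sup>F\<close>\<close>

text \<open>Only the values of \<open>v\<close> on \<open>F\<close> matter: for finite
  \<open>F\<close> this is membership of that vector in the closure of the image of the ring. One
  sequence serves all of \<open>F\<close>, and closure under ring operations reduces to limit
  laws.\<close>

definition approximable :: "('a::comm_ring_1 \<Rightarrow> real) set \<Rightarrow> (('a \<Rightarrow> real) \<Rightarrow> real) \<Rightarrow> bool" where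
  "approximable F v \<longleftrightarrow> (\<exists>x :: nat \<Rightarrow> 'a. \<forall>\<alpha>\<in>F. (\<lambda>n. \<alpha> (x n)) \<longlonglongrightarrow> v \<alpha>)"

lemma approximable_hat: "approximable F (hat a)"
  unfolding approximable_def hat_def by (intro exI[of _ "\<lambda>_. a"]) simp

lemma approximable_const:
  fixes F :: "('a::comm_ring_1 \<Rightarrow> real) set" and h :: 'a
  assumes F: "F \<subseteq> real_chars" and h: "2 * h = 1"
  shows "approximable F (\<lambda>_. r)"
  unfolding approximable_def
proof (intro exI ballI)
  fix \<alpha> assume "\<alpha> \<in> F"
  with F have \<alpha>: "\<alpha> \<in> real_chars" by blast
  \<comment> \<open>The trailing factor 1 gives the term the shape required by
    \<open>dyadic_linear_scale\<close>.\<close>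
  show "(\<lambda>n. \<alpha> (of_int \<lfloor>r * 2 ^ n\<rfloor> * h ^ n * 1)) \<longlonglongrightarrow> r"
    unfolding dyadic_linear_scale[OF real_chars_dyadic_linear[OF \<alpha> h]] real_chars_1[OF \<alpha>]
    using dyadic_floor_tendsto[of r] by simp
qed

lemma approximable_diff:
  assumes F: "F \<subseteq> real_chars" and v: "approximable F v" and w: "approximable F w"
  shows "approximable F (\<lambda>\<alpha>. v \<alpha> - w \<alpha>)"
proof -
  obtain x y where "\<forall>\<alpha>\<in>F. (\<lambda>n. \<alpha> (x n)) \<longlonglongrightarrow> v \<alpha>" "\<forall>\<alpha>\<in>F. (\<lambda>n. \<alpha> (y n)) \<longlonglongrightarrow> w \<alpha>"
    using v w by (auto simp: approximable_def)
  then have "\<forall>\<alpha>\<in>F. (\<lambda>n. \<alpha> (x n - y n)) \<longlonglongrightarrow> v \<alpha> - w \<alpha>"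
    using F by (auto simp: real_chars_diff subset_iff intro!: tendsto_diff)
  then show ?thesis unfolding approximable_def by (rule exI[of _ "\<lambda>n. x n - y n"])
qed

lemma approximable_mult:
  assumes F: "F \<subseteq> real_chars" and v: "approximable F v" and w: "approximable F w"
  shows "approximable F (\<lambda>\<alpha>. v \<alpha> * w \<alpha>)"
proof -
  obtain x y where "\<forall>\<alpha>\<in>F. (\<lambda>n. \<alpha> (x n)) \<longlonglongrightarrow> v \<alpha>" "\<forall>\<alpha>\<in>F. (\<lambda>n. \<alpha> (y n)) \<longlonglongrightarrow> w \<alpha>"
    using v w by (auto simp: approximable_def)
  then have "\<forall>\<alpha>\<in>F. (\<lambda>n. \<alpha> (x n * y n)) \<longlonglongrightarrow> v \<alpha> * w \<alpha>"
    using F by (auto simp: real_chars_mult subset_iff intro!: tendsto_mult)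
  then show ?thesis unfolding approximable_def by (rule exI[of _ "\<lambda>n. x n * y n"])
qed

lemma approximable_prod:
  fixes h :: "'a::comm_ring_1" and F :: "('a \<Rightarrow> real) set"
  assumes F: "F \<subseteq> real_chars" and h: "2 * h = 1"
    and v: "\<And>i. i \<in> I \<Longrightarrow> approximable F (v i)"
  shows "approximable F (\<lambda>\<alpha>. \<Prod>i\<in>I. v i \<alpha>)"
  using v
\<comment> \<open>Over an infinite \<open>I\<close> the product has the default value 1, so that
  case is a constant, like the empty product.\<close>
proof (induction I rule: infinite_finite_induct)
  case (insert i I)
  then show ?case using approximable_mult[OF F] by simp
qed (simp_all add: approximable_const[OF F h])

text \<open>Lagrange interpolation: for each \<beta> other than \<alpha> pick a ring element
  separating the two, and form an affine factor that is 0 at \<beta> and 1 at \<alpha>. Its real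
  coefficients need not come from the ring, so the product is only approximable.\<close>

lemma approximable_indicator:
  fixes h :: "'a::comm_ring_1" and F :: "('a \<Rightarrow> real) set"
  assumes fin: "finite F" and F: "F \<subseteq> real_chars" and h: "2 * h = 1" and \<alpha>: "\<alpha> \<in> F"
  shows "approximable F (\<lambda>\<beta>. of_bool (\<beta> = \<alpha>))"
proof -
  have "\<exists>a. \<alpha> a \<noteq> \<beta> a" if "\<beta> \<noteq> \<alpha>" for \<beta>
    using that by auto
  then obtain s where s: "\<beta> \<noteq> \<alpha> \<Longrightarrow> \<alpha> (s \<beta>) \<noteq> \<beta> (s \<beta>)" for \<beta>
    by metis
  define v where
    "v = (\<lambda>\<beta> \<gamma>. (hat (s \<beta>) \<gamma> - \<beta> (s \<beta>)) * inverse (\<alpha> (s \<beta>) - \<beta> (s \<beta>)))"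
  have "approximable F (v \<beta>)" for \<beta>
    unfolding v_def
    by (intro approximable_mult approximable_diff approximable_hat approximable_const[OF F h] F)
  then have "approximable F (\<lambda>\<gamma>. \<Prod>\<beta>\<in>F - {\<alpha>}. v \<beta> \<gamma>)"
    by (intro approximable_prod[OF F h])
  moreover have "(\<Prod>\<beta>\<in>F - {\<alpha>}. v \<beta> \<gamma>) = of_bool (\<gamma> = \<alpha>)" if "\<gamma> \<in> F" for \<gamma>
  proof (cases "\<gamma> = \<alpha>")
    case True
    then show ?thesis using s by (auto simp: v_def hat_def intro!: prod.neutral)
  next
    case False
    then show ?thesis
      using that fin by (auto simp: v_def hat_def intro!: prod_zero bexI[of _ \<gamma>])
  qed
  ultimately show ?thesis by (simp add: approximable_def)
qed

section \<open>From continuity to a nonnegative combination of finitely many characters\<close>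

text \<open>Continuity at 0 gives one ball, over a finite \<open>F\<close>, on which
  \<open>L\<close> has absolute value below 1. Scaling by \<open>2 ^ m\<close> shrinks the radius
  and the bound together, so the same \<open>F\<close> serves every \<delta>.\<close>

lemma seminorm_continuous_finite_control:
  fixes h :: "'a::comm_ring_1"
  assumes K: "K \<subseteq> real_chars" and h: "2 * h = 1" and L: "dyadic_linear h L"
    and cont: "continuous_map (seminorm_topology K) euclideanreal L"
  obtains F where "finite F" "F \<subseteq> K"
    "\<And>\<delta>. \<delta> > 0 \<Longrightarrow> \<exists>\<eta>>0. \<forall>a. (\<forall>\<alpha>\<in>F. \<bar>\<alpha> a\<bar> < \<eta>) \<longrightarrow> \<bar>L a\<bar> < \<delta>"
proof -
  have "openin (seminorm_topology K) UNIV"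
    unfolding openin_seminorm_topology_iff[OF K] by (auto intro!: exI[of _ "{}"] exI[of _ 1])
  then have top: "topspace (seminorm_topology K) = UNIV"
    using openin_subset by blast
  have "openin (seminorm_topology K) {a. L a \<in> {-1<..<1}}"
    using openin_continuous_map_preimage[OF cont, of "{-1<..<1}"] by (simp add: top)
  moreover have "0 \<in> {a. L a \<in> {-1<..<1}}"
    using additive.zero[OF dyadic_linear_additive[OF L]] by simp
  ultimately obtain F \<epsilon> where F: "finite F" "F \<subseteq> K" "\<epsilon> > 0"
    and sub: "seminorm_ball F 0 \<epsilon> \<subseteq> {a. L a \<in> {-1<..<1}}"
    unfolding openin_seminorm_topology_iff[OF K] by meson
  have ball: "\<bar>L a\<bar> < 1" if "\<forall>\<alpha>\<in>F. \<bar>\<alpha> a\<bar> < \<epsilon>" for a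
  proof -
    have "\<bar>\<alpha> (0 - a)\<bar> < \<epsilon>" if \<alpha>: "\<alpha> \<in> F" for \<alpha>
    proof -
      have "\<alpha> (- a) = - \<alpha> a"
        using \<alpha> F(2) K by (intro additive.minus real_chars_additive) auto
      then show ?thesis using \<open>\<forall>\<alpha>\<in>F. \<bar>\<alpha> a\<bar> < \<epsilon>\<close> \<alpha> by simp
    qed
    then have "a \<in> seminorm_ball F 0 \<epsilon>"
      unfolding seminorm_ball_def by blast
    then show ?thesis using sub by auto
  qed
  show thesis
  proof (rule that[OF F(1,2)])
    fix \<delta> :: real assume "\<delta> > 0"
    then obtain m where m: "(1/2) ^ m < \<delta>"
      using real_arch_pow_inv[of \<delta> "1/2"] by auto
    have "\<bar>L a\<bar> < \<delta>" if a: "\<forall>\<alpha>\<in>F. \<bar>\<alpha> a\<bar> < \<epsilon> / 2 ^ m" for a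
    proof -
      \<comment> \<open>The factor \<open>h ^ 0\<close> only makes
        \<open>dyadic_linear_scale\<close> applicable, with exponent 0.\<close>
      let ?b = "of_int (2 ^ m) * h ^ 0 * a"
      have "\<bar>\<alpha> ?b\<bar> < \<epsilon>" if \<alpha>: "\<alpha> \<in> F" for \<alpha>
      proof -
        have "\<alpha> ?b = 2 ^ m * \<alpha> a"
          using \<alpha> F(2) K
          by (subst dyadic_linear_scale[OF real_chars_dyadic_linear[OF _ h]]) auto
        moreover have "2 ^ m * \<bar>\<alpha> a\<bar> < \<epsilon>"
          using bspec[OF a \<alpha>] by (simp add: field_simps)
        ultimately show ?thesis by (simp only: abs_mult power_abs abs_numeral)
      qed
      then have "\<bar>L ?b\<bar> < 1"
        using ball by blast
      moreover have "L ?b = 2 ^ m * L a"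
        by (subst dyadic_linear_scale[OF L]) simp
      ultimately have "\<bar>L a\<bar> < (1/2) ^ m"
        by (simp add: abs_mult field_simps power_divide)
      then show ?thesis using m by simp
    qed
    then show "\<exists>\<eta>>0. \<forall>a. (\<forall>\<alpha>\<in>F. \<bar>\<alpha> a\<bar> < \<eta>) \<longrightarrow> \<bar>L a\<bar> < \<delta>"
      using F(3) by (intro exI[of _ "\<epsilon> / 2 ^ m"]) simp
  qed
qed

text \<open>By \<open>control\<close>, the limit of \<open>L\<close> along a sequence depends only
  on the limits of its values on \<open>F\<close>. This is the continuous extension of
  \<open>L\<close> to \<open>\<real>\<^sup>F\<close> expressed through sequences, and
  \<open>c \<alpha>\<close> is its value at the unit vector of \<alpha>.\<close>

lemma finite_control_representation:
  fixes h :: "'a::comm_ring_1"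
  assumes fin: "finite F" and F: "F \<subseteq> real_chars" and h: "2 * h = 1" and L: "dyadic_linear h L"
    and control: "\<And>\<delta>. \<delta> > 0 \<Longrightarrow> \<exists>\<eta>>0. \<forall>a. (\<forall>\<alpha>\<in>F. \<bar>\<alpha> a\<bar> < \<eta>) \<longrightarrow> \<bar>L a\<bar> < \<delta>"
    and d: "d \<ge> 1" and nonneg: "\<And>a. L (a ^ (2 * d)) \<ge> 0"
  obtains c where "\<And>\<alpha>. \<alpha> \<in> F \<Longrightarrow> c \<alpha> \<ge> 0" "\<And>a. L a = (\<Sum>\<alpha>\<in>F. c \<alpha> * \<alpha> a)"
proof -
  interpret L: additive L by (rule dyadic_linear_additive[OF L])
  have chars: "\<alpha> \<in> real_chars" if "\<alpha> \<in> F" for \<alpha> using that F by blast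

  have L_null: "(\<lambda>n. L (x n)) \<longlonglongrightarrow> 0" if x: "\<And>\<alpha>. \<alpha> \<in> F \<Longrightarrow> (\<lambda>n. \<alpha> (x n)) \<longlonglongrightarrow> 0" for x
  proof (rule tendstoI)
    fix e :: real assume "e > 0"
    then obtain \<eta> where \<eta>: "\<eta> > 0" "\<And>a. (\<forall>\<alpha>\<in>F. \<bar>\<alpha> a\<bar> < \<eta>) \<Longrightarrow> \<bar>L a\<bar> < e"
      using control by blast
    \<comment> \<open>Finiteness of \<open>F\<close> turns convergence at each character into a
      bound holding on all of \<open>F\<close> at once.\<close>
    have "\<forall>\<^sub>F n in sequentially. \<forall>\<alpha>\<in>F. \<bar>\<alpha> (x n)\<bar> < \<eta>"
    proof (intro eventually_ball_finite fin ballI)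
      fix \<alpha> assume "\<alpha> \<in> F"
      from tendstoD[OF x[OF this] \<eta>(1)] show "\<forall>\<^sub>F n in sequentially. \<bar>\<alpha> (x n)\<bar> < \<eta>"
        by (simp add: dist_real_def)
    qed
    then show "\<forall>\<^sub>F n in sequentially. dist (L (x n)) 0 < e"
      by eventually_elim (simp add: \<eta>(2))
  qed

  have L_convergent: "convergent (\<lambda>n. L (x n))" if x: "\<And>\<alpha>. \<alpha> \<in> F \<Longrightarrow> (\<lambda>n. \<alpha> (x n)) \<longlonglongrightarrow> v \<alpha>" for x v
  proof (rule Cauchy_convergent, rule metric_CauchyI)
    fix e :: real assume "e > 0"
    then obtain \<eta> where \<eta>: "\<eta> > 0" "\<And>a. (\<forall>\<alpha>\<in>F. \<bar>\<alpha> a\<bar> < \<eta>) \<Longrightarrow> \<bar>L a\<bar> < e"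
      using control by blast
    have "\<forall>\<^sub>F n in sequentially. \<forall>\<alpha>\<in>F. \<bar>\<alpha> (x n) - v \<alpha>\<bar> < \<eta> / 2"
    proof (intro eventually_ball_finite fin ballI)
      fix \<alpha> assume "\<alpha> \<in> F"
      from tendstoD[OF x[OF this], of "\<eta> / 2"] \<eta>(1)
      show "\<forall>\<^sub>F n in sequentially. \<bar>\<alpha> (x n) - v \<alpha>\<bar> < \<eta> / 2"
        by (simp add: dist_real_def)
    qed
    then obtain N where N: "\<And>n \<alpha>. n \<ge> N \<Longrightarrow> \<alpha> \<in> F \<Longrightarrow> \<bar>\<alpha> (x n) - v \<alpha>\<bar> < \<eta> / 2"
      by (auto simp: eventually_sequentially)
    have "dist (L (x m)) (L (x n)) < e" if "m \<ge> N" "n \<ge> N" for m n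
    proof -
      have "\<bar>\<alpha> (x m - x n)\<bar> < \<eta>" if "\<alpha> \<in> F" for \<alpha>
        using N[OF \<open>m \<ge> N\<close> that] N[OF \<open>n \<ge> N\<close> that] real_chars_diff[OF chars[OF that], of "x m" "x n"]
        by linarith
      then show ?thesis
        using \<eta>(2)[of "x m - x n"] by (simp add: dist_real_def L.diff)
    qed
    then show "\<exists>N. \<forall>m\<ge>N. \<forall>n\<ge>N. dist (L (x m)) (L (x n)) < e" by blast
  qed

  have "\<forall>\<alpha>\<in>F. \<exists>x. \<forall>\<beta>\<in>F. (\<lambda>n. \<beta> (x n)) \<longlonglongrightarrow> of_bool (\<beta> = \<alpha>)"
    using approximable_indicator[OF fin F h] by (simp add: approximable_def)
  then obtain e where
    e: "\<And>\<alpha> \<beta>. \<alpha> \<in> F \<Longrightarrow> \<beta> \<in> F \<Longrightarrow> (\<lambda>n. \<beta> (e \<alpha> n)) \<longlonglongrightarrow> of_bool (\<beta> = \<alpha>)"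
    by metis
  \<comment> \<open>The sequences \<open>e \<alpha>\<close> approximate the unit vectors;
    \<open>L_convergent\<close> makes \<open>lim\<close> an actual limit.\<close>
  define c where "c \<alpha> = lim (\<lambda>n. L (e \<alpha> n))" for \<alpha>
  have c: "(\<lambda>n. L (e \<alpha> n)) \<longlonglongrightarrow> c \<alpha>" if "\<alpha> \<in> F" for \<alpha>
    unfolding c_def convergent_LIMSEQ_iff[symmetric] using e[OF that] by (rule L_convergent)

  show thesis
  proof (rule that)
    fix \<alpha> assume \<alpha>: "\<alpha> \<in> F"
    \<comment> \<open>Both 0 and 1 are fixed by the power \<open>2 * d\<close>, whose exponent is
      positive. Hence \<open>e \<alpha> n\<close> and its power have the same limits on
      \<open>F\<close>, and \<open>c \<alpha>\<close> is a limit of the nonnegative numbers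
      \<open>L (e \<alpha> n ^ (2 * d))\<close>.\<close>
    have "(\<lambda>n. L (e \<alpha> n ^ (2 * d) - e \<alpha> n)) \<longlonglongrightarrow> 0"
    proof (rule L_null)
      fix \<beta> assume \<beta>: "\<beta> \<in> F"
      have "(\<lambda>n. \<beta> (e \<alpha> n) ^ (2 * d) - \<beta> (e \<alpha> n)) \<longlonglongrightarrow> of_bool (\<beta> = \<alpha>) ^ (2 * d) - of_bool (\<beta> = \<alpha>)"
        by (intro tendsto_intros e \<alpha> \<beta>)
      moreover have "of_bool (\<beta> = \<alpha>) ^ (2 * d) - of_bool (\<beta> = \<alpha>) = (0::real)"
        using d by simp
      ultimately show "(\<lambda>n. \<beta> (e \<alpha> n ^ (2 * d) - e \<alpha> n)) \<longlonglongrightarrow> 0"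
        using chars[OF \<beta>] by (simp add: real_chars_diff real_chars_power)
    qed
    from tendsto_add[OF this c[OF \<alpha>]] have "(\<lambda>n. L (e \<alpha> n ^ (2 * d))) \<longlonglongrightarrow> c \<alpha>"
      by (simp add: L.diff)
    then show "c \<alpha> \<ge> 0"
      by (rule LIMSEQ_le_const) (use nonneg in blast)
  next
    fix a
    define q where "q \<alpha> n = \<lfloor>\<alpha> a * 2 ^ n\<rfloor>" for \<alpha> :: "'a \<Rightarrow> real" and n
    have q: "(\<lambda>n. of_int (q \<alpha> n) / 2 ^ n) \<longlonglongrightarrow> \<alpha> a" for \<alpha>
      unfolding q_def by (rule dyadic_floor_tendsto)
    \<comment> \<open>Expansion of the vector of values of \<open>a\<close> in the approximate
      basis. The coefficients are rounded to dyadics so that \<open>L\<close>, linear only over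
      \<open>\<int>[1/2]\<close>, can be applied term by term.\<close>
    define x where "x n = (\<Sum>\<alpha>\<in>F. of_int (q \<alpha> n) * h ^ n * e \<alpha> n)" for n
    have "(\<lambda>n. L (a - x n)) \<longlonglongrightarrow> 0"
    proof (rule L_null)
      fix \<beta> assume \<beta>: "\<beta> \<in> F"
      interpret \<beta>: additive \<beta> by (rule real_chars_additive[OF chars[OF \<beta>]])
      have "\<beta> (a - x n) = \<beta> a - (\<Sum>\<alpha>\<in>F. of_int (q \<alpha> n) / 2 ^ n * \<beta> (e \<alpha> n))" for n
        unfolding x_def \<beta>.diff \<beta>.sum
          dyadic_linear_scale[OF real_chars_dyadic_linear[OF chars[OF \<beta>] h]] ..
      moreover have "(\<lambda>n. \<beta> a - (\<Sum>\<alpha>\<in>F. of_int (q \<alpha> n) / 2 ^ n * \<beta> (e \<alpha> n)))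
          \<longlonglongrightarrow> \<beta> a - (\<Sum>\<alpha>\<in>F. \<alpha> a * of_bool (\<beta> = \<alpha>))"
        by (intro tendsto_diff tendsto_const tendsto_sum tendsto_mult q e \<beta>)
      moreover have "(\<Sum>\<alpha>\<in>F. \<alpha> a * of_bool (\<beta> = \<alpha>)) = \<beta> a"
        using fin \<beta> by (simp add: of_bool_def if_distrib cong: if_cong)
      ultimately show "(\<lambda>n. \<beta> (a - x n)) \<longlonglongrightarrow> 0" by simp
    qed
    from tendsto_diff[OF tendsto_const[of "L a"] this] have "(\<lambda>n. L (x n)) \<longlonglongrightarrow> L a"
      by (simp add: L.diff)
    moreover have "(\<lambda>n. L (x n)) \<longlonglongrightarrow> (\<Sum>\<alpha>\<in>F. \<alpha> a * c \<alpha>)"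
      unfolding x_def L.sum dyadic_linear_scale[OF L]
      by (intro tendsto_sum tendsto_mult q c)
    ultimately show "L a = (\<Sum>\<alpha>\<in>F. c \<alpha> * \<alpha> a)"
      by (simp add: LIMSEQ_unique mult.commute)
  qed
qed

section \<open>The representing measure\<close>

text \<open>Place mass \<open>c \<alpha>\<close> at each \<alpha>. Since
  \<open>point_measure\<close> carries all subsets of \<open>F\<close>, it is pushed forward along
  the inclusion to live on the Borel sets of \<open>K\<close>. Nonnegativity of \<open>c\<close>
  keeps \<open>ennreal\<close> from truncating a weight to 0.\<close>

lemma finite_point_masses:
  fixes F K :: "('a \<Rightarrow> real) set"
  assumes fin: "finite F" and sub: "F \<subseteq> K" and c: "\<And>\<alpha>. \<alpha> \<in> F \<Longrightarrow> c \<alpha> \<ge> (0::real)"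
  obtains \<mu> where "sets \<mu> = sets (restrict_space borel K)"
    "\<And>a. integrable \<mu> (hat a)" "\<And>a. (\<integral>\<alpha>. hat a \<alpha> \<partial>\<mu>) = (\<Sum>\<alpha>\<in>F. c \<alpha> * \<alpha> a)"
proof -
  let ?P = "point_measure F (\<lambda>\<alpha>. ennreal (c \<alpha>))" and ?B = "restrict_space borel K"
  have id: "(\<lambda>\<alpha>. \<alpha>) \<in> measurable ?P ?B"
    using sub by (auto simp: measurable_point_measure_eq1 space_restrict_space)
  \<comment> \<open>Evaluation at \<open>a\<close> is a coordinate projection, continuous for the
    product topology.\<close>
  have "hat a \<in> borel_measurable borel" for a :: 'a
    unfolding hat_def by (intro borel_measurable_continuous_onI continuous_on_product_coordinates)
  then have hat: "hat a \<in> borel_measurable ?B" for a :: 'a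
    by (rule measurable_restrict_space1)
  show thesis
  proof (rule that[of "distr ?P ?B (\<lambda>\<alpha>. \<alpha>)"])
    show "integrable (distr ?P ?B (\<lambda>\<alpha>. \<alpha>)) (hat a)" for a
      using fin c by (simp add: integrable_distr_eq[OF id hat] integrable_point_measure_finite)
    show "(\<integral>\<alpha>. hat a \<alpha> \<partial>distr ?P ?B (\<lambda>\<alpha>. \<alpha>)) = (\<Sum>\<alpha>\<in>F. c \<alpha> * \<alpha> a)" for a
      unfolding integral_distr[OF id hat]
      using fin c by (simp add: lebesgue_integral_point_measure_finite hat_def)
  qed simp
qed

theorem corollary4p6:
  fixes half p :: "'a::comm_ring_1"
    and K :: "('a \<Rightarrow> real) set"
    and d :: nat
    and L :: "'a \<Rightarrow> real"
  assumes half: "2 * half = 1"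
    and chars_nonempty: "(real_chars :: ('a \<Rightarrow> real) set) \<noteq> {}"
    and hat_inj: "inj (\<lambda>a::'a. restrict (hat a) real_chars)"
    and K_closed: "closedin (top_of_set real_chars) K"
    and d_pos: "d \<ge> 1"
    and p_nonneg: "\<forall>\<alpha>\<in>K. hat p \<alpha> \<ge> 0"
    and K_compact: "\<forall>i::nat. i \<ge> 1 \<longrightarrow> compact {\<alpha> \<in> K. hat p \<alpha> \<in> {0..real i}}"
    and L_continuous: "continuous_map (seminorm_topology K) euclideanreal L"
    and L_linear: "dyadic_linear half L"
    and L_nonneg: "\<forall>a. L (a ^ (2 * d)) \<ge> 0"
  shows "\<exists>\<mu> :: ('a \<Rightarrow> real) measure.
    sets \<mu> = sets (restrict_space borel K) \<and>
    (\<forall>a. integrable \<mu> (hat a) \<and> L a = (\<integral>\<alpha>. hat a \<alpha> \<partial>\<mu>))"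
proof -
  have K: "K \<subseteq> real_chars"
    using closedin_subset[OF K_closed] by simp
  obtain F where F: "finite F" "F \<subseteq> K"
    and control: "\<And>\<delta>. \<delta> > 0 \<Longrightarrow> \<exists>\<eta>>0. \<forall>a. (\<forall>\<alpha>\<in>F. \<bar>\<alpha> a\<bar> < \<eta>) \<longrightarrow> \<bar>L a\<bar> < \<delta>"
    using seminorm_continuous_finite_control[OF K half L_linear L_continuous] by blast
  have "F \<subseteq> real_chars" using F(2) K by blast
  then obtain c where c: "\<And>\<alpha>. \<alpha> \<in> F \<Longrightarrow> c \<alpha> \<ge> 0" "\<And>a. L a = (\<Sum>\<alpha>\<in>F. c \<alpha> * \<alpha> a)"
    using finite_control_representation[OF F(1) _ half L_linear control d_pos] L_nonneg by blast
  obtain \<mu> where "sets \<mu> = sets (restrict_space borel K)"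
    "\<And>a. integrable \<mu> (hat a)" "\<And>a. (\<integral>\<alpha>. hat a \<alpha> \<partial>\<mu>) = (\<Sum>\<alpha>\<in>F. c \<alpha> * \<alpha> a)"
    by (rule finite_point_masses[OF F, where c = c]) (use c(1) in blast)+
  with c(2) show ?thesis by (intro exI[of _ \<mu>]) simp
qed

end
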